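(* Let $\mathcal{H}$ be a complex Hilbert space and let $A,B\in\mathcal{B}(\mathcal{H})$. Then $$\frac{1}{2}\Big(\max\left\{dw(A+B),\,dw(A-B)\right\}-\|A^*B+B^*A\|\Big)\leq dw\begin{pmatrix} 0 & A\\ B & 0\end{pmatrix}.$$
   Context: $\mathcal{B}(\mathcal{H})$ is the algebra of bounded linear operators on the complex Hilbert space $\mathcal{H}$, with operator norm $\|\cdot\|$. A $2\times2$ operator matrix acts on the Hilbert space direct sum $\mathcal{H}\oplus\mathcal{H}$ (norm $\|(x,y)\|^2=\|x\|^2+\|y\|^2$) in the usual way. For a bounded operator $T$ on a complex Hilbert space, the Davis-Wielandt radius is $dw(T)=\sup\{\sqrt{|\langle Tz,z\rangle|^2+\|Tz\|^4}: \|z\|=1\}$. *)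

theory Defs
  imports "HOL-Analysis.Analysis"
begin

text \<open>
  Complex inner product spaces, as the complex counterpart of \<^class>\<open>real_inner\<close>.
  The inner product is linear in its first and conjugate-linear in its second argument.
\<close>

class complex_inner = real_normed_vector +
  fixes scaleC :: "complex \<Rightarrow> 'a \<Rightarrow> 'a"  (infixr "*\<^sub>C" 75)
    and cinner :: "'a \<Rightarrow> 'a \<Rightarrow> complex"
  assumes scaleC_add_right: "a *\<^sub>C (x + y) = a *\<^sub>C x + a *\<^sub>C y"
    and scaleC_add_left: "(a + b) *\<^sub>C x = a *\<^sub>C x + b *\<^sub>C x"
    and scaleC_scaleC: "a *\<^sub>C (b *\<^sub>C x) = (a * b) *\<^sub>C x"
    and scaleC_of_real: "complex_of_real r *\<^sub>C x = r *\<^sub>R x"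
    and cinner_commute: "cinner x y = cnj (cinner y x)"
    and cinner_add_left: "cinner (x + y) z = cinner x z + cinner y z"
    and cinner_scaleC_left: "cinner (a *\<^sub>C x) y = a * cinner x y"
    and cinner_ge_zero: "0 \<le> Re (cinner x x)"
    and cinner_eq_zero_iff: "cinner x x = 0 \<longleftrightarrow> x = 0"
    and norm_eq_sqrt_cinner: "norm x = sqrt (Re (cinner x x))"

class chilbert_space = complex_inner + complete_space

text \<open>
  The Hilbert space direct sum is the product type; its norm, inherited from
  \<^theory>\<open>HOL-Analysis.Product_Vector\<close>, satisfies
  \<open>norm (x, y) = sqrt ((norm x)\<^sup>2 + (norm y)\<^sup>2)\<close>.
\<close>

instantiation prod :: (complex_inner, complex_inner) complex_inner
begin

definition scaleC_prod :: "complex \<Rightarrow> 'a \<times> 'b \<Rightarrow> 'a \<times> 'b"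
  where "scaleC_prod a p = (a *\<^sub>C fst p, a *\<^sub>C snd p)"

definition cinner_prod :: "'a \<times> 'b \<Rightarrow> 'a \<times> 'b \<Rightarrow> complex"
  where "cinner_prod p q = cinner (fst p) (fst q) + cinner (snd p) (snd q)"

instance
proof
  fix a b :: complex and r :: real and x y z :: "'a \<times> 'b"
  have im: "Im (cinner u u) = 0" for u :: "'c::complex_inner"
    using arg_cong[OF cinner_commute[of u u], of Im] by simp
  show "a *\<^sub>C (x + y) = a *\<^sub>C x + a *\<^sub>C y"
    by (simp add: scaleC_prod_def scaleC_add_right)
  show "(a + b) *\<^sub>C x = a *\<^sub>C x + b *\<^sub>C x"
    by (simp add: scaleC_prod_def scaleC_add_left)
  show "a *\<^sub>C (b *\<^sub>C x) = (a * b) *\<^sub>C x"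
    by (simp add: scaleC_prod_def scaleC_scaleC)
  show "complex_of_real r *\<^sub>C x = r *\<^sub>R x"
    by (simp add: scaleC_prod_def scaleC_of_real scaleR_prod_def)
  show "cinner x y = cnj (cinner y x)"
    unfolding cinner_prod_def complex_cnj_add
    by (metis cinner_commute)
  show "cinner (x + y) z = cinner x z + cinner y z"
    by (simp add: cinner_prod_def cinner_add_left)
  show "cinner (a *\<^sub>C x) y = a * cinner x y"
    by (simp add: cinner_prod_def scaleC_prod_def cinner_scaleC_left distrib_left)
  show "0 \<le> Re (cinner x x)"
    by (simp add: cinner_prod_def cinner_ge_zero)
  have re: "Re (cinner u u) = 0 \<longleftrightarrow> u = 0" for u :: "'c::complex_inner"
    using cinner_eq_zero_iff[of u] im[of u] by (simp add: complex_eq_iff)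
  show "cinner x x = 0 \<longleftrightarrow> x = 0"
    by (simp add: cinner_prod_def complex_eq_iff im re add_nonneg_eq_0_iff
        cinner_ge_zero prod_eq_iff)
  show "norm x = sqrt (Re (cinner x x))"
    by (simp add: cinner_prod_def norm_prod_def norm_eq_sqrt_cinner cinner_ge_zero)
qed

end

instance prod :: (chilbert_space, chilbert_space) chilbert_space ..

definition bounded_clinear :: "('a::complex_inner \<Rightarrow> 'b::complex_inner) \<Rightarrow> bool"
  where "bounded_clinear T \<longleftrightarrow> bounded_linear T \<and> (\<forall>c x. T (c *\<^sub>C x) = c *\<^sub>C T x)"

text \<open>Well-defined for bounded operators on a Hilbert space, by the Riesz representation theorem.\<close>

definition cadjoint :: "('a::chilbert_space \<Rightarrow> 'b::chilbert_space) \<Rightarrow> 'b \<Rightarrow> 'a"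
  where "cadjoint T = (THE S. \<forall>x y. cinner (T x) y = cinner x (S y))"

text \<open>
  The zero space has no unit vectors. There the supremum of the empty set of nonnegative
  numbers is taken to be \<open>0\<close>, since \<^term>\<open>Sup {} :: real\<close> is an unspecified value.
\<close>

definition dw :: "('a::chilbert_space \<Rightarrow> 'a) \<Rightarrow> real"
  where "dw T =
    (if \<exists>z::'a. norm z = 1
     then SUP z\<in>{z. norm z = 1}. sqrt ((cmod (cinner (T z) z))\<^sup>2 + norm (T z) ^ 4)
     else 0)"

definition op_matrix ::
  "('a \<Rightarrow> 'a) \<Rightarrow> ('a \<Rightarrow> 'a) \<Rightarrow> ('a \<Rightarrow> 'a) \<Rightarrow> ('a \<Rightarrow> 'a) \<Rightarrow> 'a::chilbert_space \<times> 'a \<Rightarrow> 'a \<times> 'a"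
  where "op_matrix P Q R S = (\<lambda>(x, y). (P x + Q y, R x + S y))"

end

theory Submission
  imports Defs
begin

text \<open>
  For a unit vector \<open>x\<close> and \<open>u \<in> {1, \<i>}\<close> put \<open>z = (x, u x) / \<surd>2\<close> and let \<open>T\<close> be the operator
  matrix, \<open>\<epsilon> = u\<^sup>2\<close>. Then \<open>\<bar>\<langle>T z, z\<rangle>\<bar>\<close> is half of \<open>\<bar>\<langle>(A + \<epsilon> B) x, x\<rangle>\<bar>\<close>, and
  \<open>\<parallel>(A + \<epsilon> B) x\<parallel>\<^sup>2 = 2 \<parallel>T z\<parallel>\<^sup>2 + \<epsilon> \<langle>(A\<^sup>* B + B\<^sup>* A) x, x\<rangle>\<close>. The triangle inequality in the Euclidean
  plane gives \<open>dw (A + \<epsilon> B) \<le> 2 dw T + \<parallel>A\<^sup>* B + B\<^sup>* A\<parallel>\<close>. The adjoints exist by Riesz representation,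
  obtained here by minimising \<open>\<parallel>x\<parallel>\<^sup>2 - 2 \<phi> x\<close> for a bounded real functional \<open>\<phi>\<close>.
\<close>

section \<open>Complex inner products\<close>

lemma cinner_add_right: "cinner x (y + z) = cinner x y + cinner x z"
  for x :: "'a::complex_inner"
  by (metis cinner_add_left cinner_commute complex_cnj_add)

lemma cinner_scaleC_right: "cinner x (a *\<^sub>C y) = cnj a * cinner x y"
  for x :: "'a::complex_inner"
  by (metis cinner_commute cinner_scaleC_left complex_cnj_mult)

lemma cinner_scaleR_left: "cinner (r *\<^sub>R x) y = of_real r * cinner x y"
  for x :: "'a::complex_inner"
  by (metis cinner_scaleC_left scaleC_of_real)

lemma cinner_scaleR_right: "cinner x (r *\<^sub>R y) = of_real r * cinner x y"
  for x :: "'a::complex_inner"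
  by (metis cinner_scaleC_right complex_cnj_complex_of_real scaleC_of_real)

lemma cinner_diff_right: "cinner x (y - z) = cinner x y - cinner x z"
  for x :: "'a::complex_inner"
  using cinner_add_right[of x "y - z" z] by simp

lemma cinner_self: "cinner x x = of_real ((norm x)\<^sup>2)" for x :: "'a::complex_inner"
proof -
  have "Im (cinner x x) = 0"
    using arg_cong[OF cinner_commute[of x x], of Im] by simp
  moreover have "Re (cinner x x) = (norm x)\<^sup>2"
    by (simp add: norm_eq_sqrt_cinner cinner_ge_zero)
  ultimately show ?thesis by (simp add: complex_eq_iff)
qed

lemma Re_cinner_commute: "Re (cinner x y) = Re (cinner y x)" for x :: "'a::complex_inner"
  by (subst cinner_commute) simp

text \<open>This one expansion yields Cauchy-Schwarz (t = 1), the parallelogram law (t = 1 and t =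
  -1), the variation of the functional in the Riesz argument, and the cross term of
  \<open>A x + \<epsilon> *\<^sub>R B x\<close>.\<close>

lemma norm_add_scaleR_sq:
  "(norm (x + t *\<^sub>R y))\<^sup>2 = (norm x)\<^sup>2 + t\<^sup>2 * (norm y)\<^sup>2 + 2 * t * Re (cinner y x)"
  for x :: "'a::complex_inner"
proof -
  have "(norm (x + t *\<^sub>R y))\<^sup>2 = Re (cinner (x + t *\<^sub>R y) (x + t *\<^sub>R y))"
    by (simp add: cinner_self)
  also have "\<dots> = Re (cinner x x) + t\<^sup>2 * Re (cinner y y) + 2 * t * Re (cinner y x)"
    using Re_cinner_commute[of x y]
    by (simp add: cinner_add_left cinner_add_right cinner_scaleR_left cinner_scaleR_right
        algebra_simps power2_eq_square)
  finally show ?thesis by (simp add: cinner_self)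
qed

text \<open>The class already carries the triangle inequality of a normed space; squaring it and
  cancelling the squared norms leaves real Cauchy-Schwarz.\<close>

lemma Re_cinner_le: "Re (cinner x y) \<le> norm x * norm y" for x :: "'a::complex_inner"
proof -
  have "(norm (y + 1 *\<^sub>R x))\<^sup>2 \<le> (norm y + norm x)\<^sup>2"
    by (intro power_mono) (auto simp: norm_triangle_ineq)
  then show ?thesis
    unfolding norm_add_scaleR_sq by (simp add: power2_sum algebra_simps)
qed

text \<open>The class axioms give homogeneity of the norm for real scalars; for complex ones it
  follows by pulling the scalar out of both arguments of the inner product.\<close>

lemma norm_scaleC: "norm (a *\<^sub>C x) = cmod a * norm x" for x :: "'a::complex_inner"
proof -
  have "complex_of_real ((norm (a *\<^sub>C x))\<^sup>2) = (a * cnj a) * cinner x x"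
    unfolding cinner_self[symmetric]
    by (simp add: cinner_scaleC_left cinner_scaleC_right)
  also have "\<dots> = of_real ((cmod a * norm x)\<^sup>2)"
    by (simp add: cinner_self power_mult_distrib flip: complex_norm_square)
  finally have "(norm (a *\<^sub>C x))\<^sup>2 = (cmod a * norm x)\<^sup>2"
    using of_real_eq_iff by blast
  then show ?thesis by simp
qed

lemma cmod_cinner_le: "cmod (cinner x y) \<le> norm x * norm y" for x :: "'a::complex_inner"
proof (cases "cinner x y = 0")
  case False
  \<comment> \<open>The phase \<open>u\<close> rotates \<open>x\<close> so that the inner product
    becomes real and nonnegative, which reduces the claim to the bound on real parts.\<close>
  define u where "u = cnj (cinner x y) / cmod (cinner x y)"
  have u: "cmod u = 1"
    using False by (simp add: u_def norm_divide)
  have "u * cinner x y = cmod (cinner x y)"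
    using False complex_norm_square[of "cinner x y"]
    by (simp add: u_def field_simps power2_eq_square)
  then have "cmod (cinner x y) = Re (cinner (u *\<^sub>C x) y)"
    by (simp add: cinner_scaleC_left)
  also have "\<dots> \<le> norm x * norm y"
    using Re_cinner_le[of "u *\<^sub>C x" y] by (simp add: norm_scaleC u)
  finally show ?thesis .
qed simp

lemma cinner_eqI:
  fixes v w :: "'a::complex_inner"
  assumes "\<And>x. cinner x v = cinner x w"
  shows "v = w"
proof -
  have "cinner (v - w) (v - w) = 0"
    using assms by (simp add: cinner_diff_right)
  then show ?thesis by (simp add: cinner_eq_zero_iff)
qed

section \<open>Riesz representation and adjoints\<close>

text \<open>If \<open>w\<close> represents \<open>\<phi>\<close>, completing the square turns
  \<open>J x\<close> below into the squared distance from \<open>x\<close> to \<open>w\<close> minus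
  the squared norm of \<open>w\<close>. So \<open>w\<close> is sought as a minimiser of
  \<open>J\<close>, and completeness provides it.\<close>

lemma riesz_representation_Re:
  fixes \<phi> :: "'a::chilbert_space \<Rightarrow> real"
  assumes "bounded_linear \<phi>"
  shows "\<exists>w. \<forall>x. \<phi> x = Re (cinner x w)"
proof -
  interpret bounded_linear \<phi> by fact
  define J where "J x = (norm x)\<^sup>2 - 2 * \<phi> x" for x
  define m where "m = Inf (range J)"
  obtain K where K: "\<And>x. norm (\<phi> x) \<le> norm x * K"
    using bounded by blast
  have "- K\<^sup>2 \<le> J x" for x
  proof -
    have "0 \<le> (norm x - K)\<^sup>2" by simp
    then have "- K\<^sup>2 \<le> (norm x)\<^sup>2 - 2 * (norm x * K)"
      by (simp add: power2_diff)
    with K[of x] show ?thesis by (simp add: J_def)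
  qed
  then have "bdd_below (range J)"
    by (intro bdd_belowI2)
  then have m_le: "m \<le> J x" for x
    unfolding m_def by (simp add: cInf_lower)
  have "\<exists>x. J x < m + inverse (real (Suc n))" for n
    using cInf_lessD[of "range J" "m + inverse (real (Suc n))"] by (auto simp: m_def)
  then obtain X where X: "\<And>n. J (X n) < m + inverse (real (Suc n))"
    by metis
  \<comment> \<open>Since \<open>J\<close> is at least \<open>m\<close> at the midpoint, two
    near-minimisers must lie close together; hence every minimising sequence is Cauchy.\<close>
  have parallelogram: "(norm (x - y))\<^sup>2 \<le> 2 * (J x + J y - 2 * m)" for x y
  proof -
    have "J ((1/2) *\<^sub>R (x + y)) = (norm (x + y))\<^sup>2 / 4 - \<phi> x - \<phi> y"
      by (simp add: J_def scaleR add power_divide add_divide_distrib)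
    moreover have "(norm (x + y))\<^sup>2 + (norm (x - y))\<^sup>2 = 2 * (norm x)\<^sup>2 + 2 * (norm y)\<^sup>2"
      using norm_add_scaleR_sq[of x 1 y] norm_add_scaleR_sq[of x "-1" y] by simp
    ultimately show ?thesis
      using m_le[of "(1/2) *\<^sub>R (x + y)"] by (simp add: J_def)
  qed
  have "Cauchy X"
  proof (rule metric_CauchyI)
    fix e :: real
    assume e: "0 < e"
    then obtain N where N: "inverse (real (Suc N)) < e\<^sup>2 / 4"
      using reals_Archimedean[of "e\<^sup>2 / 4"] by auto
    \<comment> \<open>The excess \<open>e\<^sup>2 / 4\<close> occurs for two points and is doubled
      by \<open>parallelogram\<close>, which makes exactly \<open>e\<^sup>2\<close>.\<close>
    have J_less: "J (X n) < m + e\<^sup>2 / 4" if "N \<le> n" for n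
    proof -
      have "inverse (real (Suc n)) \<le> inverse (real (Suc N))"
        using that by (simp add: le_imp_inverse_le)
      with N X[of n] show ?thesis by linarith
    qed
    have "dist (X i) (X j) < e" if "N \<le> i" "N \<le> j" for i j
    proof -
      have "(norm (X i - X j))\<^sup>2 < e\<^sup>2"
        using parallelogram[of "X i" "X j"] J_less[OF that(1)] J_less[OF that(2)] by simp
      then show ?thesis
        using e by (simp add: dist_norm power2_less_imp_less)
    qed
    then show "\<exists>N. \<forall>i\<ge>N. \<forall>j\<ge>N. dist (X i) (X j) < e" by blast
  qed
  then obtain w where w: "X \<longlonglongrightarrow> w"
    using Cauchy_convergent convergent_def by blast
  have "(\<lambda>n. J (X n)) \<longlonglongrightarrow> J w"
    unfolding J_def by (intro tendsto_intros tendsto w)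
  moreover have "(\<lambda>n. m + inverse (real (Suc n))) \<longlonglongrightarrow> m"
    by (rule LIMSEQ_inverse_real_of_nat_add)
  ultimately have "J w \<le> m"
    by (rule LIMSEQ_le) (use X less_imp_le in blast)
  have "\<phi> x = Re (cinner x w)" for x
  proof (cases "x = 0")
    case True
    then show ?thesis
      using cinner_scaleR_left[of 0 x w] by (simp add: zero)
  next
    case False
    define b where "b = Re (cinner x w) - \<phi> x"
    \<comment> \<open>This \<open>t\<close> minimises the quadratic
      \<open>t\<^sup>2 * (norm x)\<^sup>2 + 2 * t * b\<close>. Its minimum is negative unless
      \<open>b = 0\<close>, whereas minimality of \<open>w\<close> forbids a negative value.\<close>
    define t where "t = - b / (norm x)\<^sup>2"
    have "0 \<le> J (w + t *\<^sub>R x) - J w"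
      using m_le \<open>J w \<le> m\<close> by (simp add: order_trans)
    also have "\<dots> = t\<^sup>2 * (norm x)\<^sup>2 + 2 * t * b"
      by (simp add: J_def norm_add_scaleR_sq add scaleR b_def algebra_simps)
    also have "\<dots> = - b\<^sup>2 / (norm x)\<^sup>2"
      using False by (simp add: t_def field_simps power2_eq_square)
    finally have "b\<^sup>2 \<le> 0"
      using False by (simp add: divide_le_0_iff)
    then show ?thesis by (simp add: b_def)
  qed
  then show ?thesis by blast
qed

text \<open>This justifies the definite description in \<open>cadjoint\<close>: Riesz representation
  gives existence, and \<open>cinner_eqI\<close> gives uniqueness.\<close>

lemma cinner_cadjoint:
  fixes T :: "'a::chilbert_space \<Rightarrow> 'b::chilbert_space"
  assumes "bounded_clinear T"
  shows "cinner (T x) y = cinner x (cadjoint T y)"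
proof -
  interpret bounded_linear T
    using assms by (simp add: bounded_clinear_def)
  have TC: "T (c *\<^sub>C x) = c *\<^sub>C T x" for c x
    using assms by (simp add: bounded_clinear_def)
  obtain K where K: "\<And>x. norm (T x) \<le> norm x * K"
    using bounded by blast
  have "\<exists>w. \<forall>x. cinner (T x) y = cinner x w" for y
  proof -
    have "bounded_linear (\<lambda>x. Re (cinner (T x) y))"
    proof (rule bounded_linear_intro)
      show "norm (Re (cinner (T x) y)) \<le> norm x * (K * norm y)" for x
      proof -
        have "norm (Re (cinner (T x) y)) \<le> norm (T x) * norm y"
          using abs_Re_le_cmod cmod_cinner_le by (metis order_trans real_norm_def)
        also have "\<dots> \<le> (norm x * K) * norm y"
          by (intro mult_right_mono K) simp
        finally show ?thesis by (simp add: mult.assoc)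
      qed
    qed (simp_all add: add scaleR cinner_add_left cinner_scaleR_left)
    from riesz_representation_Re[OF this]
    obtain w where w: "\<And>x. Re (cinner (T x) y) = Re (cinner x w)" by blast
    \<comment> \<open>Real parts at \<open>x\<close> and at \<open>\<i> *\<^sub>C x\<close>
      determine the real and imaginary parts at \<open>x\<close>, because \<open>T\<close> is
      complex linear.\<close>
    have "cinner (T x) y = cinner x w" for x
      using w[of x] w[of "\<i> *\<^sub>C x"] by (simp add: TC cinner_scaleC_left complex_eq_iff)
    then show ?thesis by blast
  qed
  then obtain S where S: "\<forall>x y. cinner (T x) y = cinner x (S y)"
    by metis
  have "\<forall>x y. cinner (T x) y = cinner x (cadjoint T y)"
    unfolding cadjoint_def
  proof (rule theI[of _ S])
    show "S' = S" if "\<forall>x y. cinner (T x) y = cinner x (S' y)" for S'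
      using S that by (intro ext cinner_eqI) metis
  qed (rule S)
  then show ?thesis by blast
qed

text \<open>Boundedness is needed for \<open>onorm\<close> to control the operator built from the
  adjoints pointwise. It comes from testing the adjoint relation at \<open>cadjoint T x\<close>
  itself and dividing by its norm.\<close>

lemma bounded_linear_cadjoint:
  fixes T :: "'a::chilbert_space \<Rightarrow> 'b::chilbert_space"
  assumes T: "bounded_clinear T"
  shows "bounded_linear (cadjoint T)"
proof -
  interpret bounded_linear T
    using T by (simp add: bounded_clinear_def)
  obtain K where K: "\<And>x. norm (T x) \<le> norm x * K" "0 \<le> K"
    using nonneg_bounded by blast
  note adj = cinner_cadjoint[OF T, symmetric]
  show ?thesis
  proof (rule bounded_linear_intro)
    fix x y :: 'b and r :: real
    show "cadjoint T (x + y) = cadjoint T x + cadjoint T y"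
      by (rule cinner_eqI) (simp add: cinner_add_right adj)
    show "cadjoint T (r *\<^sub>R x) = r *\<^sub>R cadjoint T x"
      by (rule cinner_eqI) (simp add: cinner_scaleR_right adj)
    let ?w = "cadjoint T x"
    have "(norm ?w)\<^sup>2 = Re (cinner (T ?w) x)"
      using arg_cong[OF cinner_self[of ?w], of Re] by (simp add: adj)
    also have "\<dots> \<le> norm (T ?w) * norm x"
      by (rule Re_cinner_le)
    also have "\<dots> \<le> (norm ?w * K) * norm x"
      by (intro mult_right_mono K) simp
    finally have "norm ?w * norm ?w \<le> norm ?w * (norm x * K)"
      by (simp add: power2_eq_square mult_ac)
    then show "norm ?w \<le> norm x * K"
      using K(2) by (cases "?w = 0") simp_all
  qed
qed

section \<open>The Davis--Wielandt radius\<close>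

text \<open>A real supremum bounds its members once the set is bounded above; here an operator bound
  \<open>K\<close> supplies \<open>sqrt (K\<^sup>2 + K ^ 4)\<close>.\<close>

lemma dw_upper:
  fixes T :: "'a::chilbert_space \<Rightarrow> 'a"
  assumes "bounded_linear T" and z: "norm z = 1"
  shows "sqrt ((cmod (cinner (T z) z))\<^sup>2 + norm (T z) ^ 4) \<le> dw T"
proof -
  interpret bounded_linear T by fact
  obtain K where K: "\<And>x. norm (T x) \<le> norm x * K"
    using bounded by blast
  have "sqrt ((cmod (cinner (T x) x))\<^sup>2 + norm (T x) ^ 4) \<le> sqrt (K\<^sup>2 + K ^ 4)"
    if "norm x = 1" for x
  proof -
    have "norm (T x) \<le> K"
      using K[of x] that by simp
    moreover have "cmod (cinner (T x) x) \<le> norm (T x)"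
      using cmod_cinner_le[of "T x" x] that by simp
    ultimately show ?thesis
      by (intro real_sqrt_le_mono add_mono power_mono) auto
  qed
  then have "bdd_above ((\<lambda>z. sqrt ((cmod (cinner (T z) z))\<^sup>2 + norm (T z) ^ 4)) ` {z. norm z = 1})"
    by (intro bdd_aboveI2[where M = "sqrt (K\<^sup>2 + K ^ 4)"]) simp
  then show ?thesis
    unfolding dw_def using z by (auto intro: cSUP_upper)
qed

text \<open>The assumption \<open>0 \<le> M\<close> handles the zero space, where there is no unit
  vector and \<open>dw\<close> is 0 by definition.\<close>

lemma dw_least:
  fixes T :: "'a::chilbert_space \<Rightarrow> 'a"
  assumes "\<And>z. norm z = 1 \<Longrightarrow> sqrt ((cmod (cinner (T z) z))\<^sup>2 + norm (T z) ^ 4) \<le> M"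
    and "0 \<le> M"
  shows "dw T \<le> M"
  using assms by (auto simp: dw_def intro: cSUP_least)

lemma dw_nonneg:
  fixes T :: "'a::chilbert_space \<Rightarrow> 'a"
  assumes "bounded_linear T"
  shows "0 \<le> dw T"
proof (cases "\<exists>z::'a. norm z = 1")
  case True
  then obtain z :: 'a where "norm z = 1" by blast
  then show ?thesis
    using dw_upper[OF assms] by (meson order_trans real_sqrt_ge_zero zero_le_even_power'
        add_nonneg_nonneg zero_le_power2 zero_le_power norm_ge_zero)
qed (simp add: dw_def)

lemma bounded_linear_op_matrix:
  assumes "bounded_linear P" "bounded_linear Q" "bounded_linear R" "bounded_linear S"
  shows "bounded_linear (op_matrix P Q R S)"
proof -
  have "bounded_linear (\<lambda>p. (P (fst p) + Q (snd p), R (fst p) + S (snd p)))"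
    by (intro bounded_linear_Pair bounded_linear_add bounded_linear_compose[OF assms(1)]
        bounded_linear_compose[OF assms(2)] bounded_linear_compose[OF assms(3)]
        bounded_linear_compose[OF assms(4)] bounded_linear_fst bounded_linear_snd)
  then show ?thesis
    by (simp add: op_matrix_def case_prod_unfold)
qed

text \<open>Sum and difference are treated together: \<open>u = 1\<close> gives
  \<open>\<epsilon> = 1\<close>, and \<open>u = \<i>\<close> gives
  \<open>\<epsilon> = -1\<close>.\<close>

lemma dw_add_scaleR_le:
  fixes A B :: "'a::chilbert_space \<Rightarrow> 'a" and u :: complex and \<epsilon> :: real
  assumes A: "bounded_clinear A" and B: "bounded_clinear B"
    and u: "u\<^sup>2 = of_real \<epsilon>" and \<epsilon>: "\<bar>\<epsilon>\<bar> = 1"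
  shows "dw (\<lambda>x. A x + \<epsilon> *\<^sub>R B x) \<le> 2 * dw (op_matrix (\<lambda>_. 0) A B (\<lambda>_. 0))
    + onorm (\<lambda>x. cadjoint A (B x) + cadjoint B (A x))"
proof -
  let ?T = "op_matrix (\<lambda>_. 0) A B (\<lambda>_. 0)"
  let ?G = "\<lambda>x. cadjoint A (B x) + cadjoint B (A x)"
  have lin: "bounded_linear A" "bounded_linear B"
    using A B by (auto simp: bounded_clinear_def)
  have AC: "A (c *\<^sub>C x) = c *\<^sub>C A x" for c x
    using A by (simp add: bounded_clinear_def)
  have T: "bounded_linear ?T"
    by (intro bounded_linear_op_matrix lin bounded_linear_zero)
  have G: "bounded_linear ?G"
    by (intro bounded_linear_add bounded_linear_compose[OF bounded_linear_cadjoint] A B lin)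
  note G_nonneg = onorm_pos_le[OF G]
  have "cmod (u\<^sup>2) = 1"
    using \<epsilon> by (simp add: u)
  then have cu: "cmod u = 1"
    by (simp add: norm_power power2_eq_1_iff) (smt (verit) norm_ge_zero)
  \<comment> \<open>The aim is \<open>cnj u = u * of_real \<epsilon>\<close>, so that
    \<open>u\<close> factors out of the quadratic form of the matrix at \<open>z\<close> and leaves
    that of \<open>A x + \<epsilon> *\<^sub>R B x\<close>.\<close>
  have "u * cnj u = 1"
    using complex_norm_square[of u] cu by simp
  then have "cnj u = u * (cnj u)\<^sup>2"
    by (simp add: power2_eq_square)
  moreover have "(cnj u)\<^sup>2 = of_real \<epsilon>"
    using arg_cong[OF u, of cnj] by simp
  ultimately have cnj_u: "cnj u = u * of_real \<epsilon>"
    by simp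
  have \<epsilon>2: "\<epsilon>\<^sup>2 = 1"
    using \<epsilon> by (metis one_power2 power2_abs)
  show ?thesis
  proof (rule dw_least)
    fix x :: 'a
    assume x: "norm x = 1"
    define h where "h = 1 / sqrt 2"
    have h2: "h\<^sup>2 = 1 / 2"
      by (simp add: h_def power_divide)
    define z where "z = h *\<^sub>R (x, u *\<^sub>C x)"
    have norm_z: "norm z = 1"
      by (simp add: z_def norm_prod_def norm_scaleC cu x power_mult_distrib h2)
    have Tz: "?T z = h *\<^sub>R (u *\<^sub>C A x, B x)"
      using lin by (simp add: z_def op_matrix_def AC linear_simps)
    \<comment> \<open>With \<open>t\<close> the squared norm, the quantity inside the supremum for
      \<open>?T\<close> at \<open>z\<close> is the length of the plane vector (s, t).\<close>
    define s where "s = cmod (cinner (?T z) z)"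
    define t where "t = (norm (?T z))\<^sup>2"
    have "cinner (?T z) z = of_real (h\<^sup>2) * (u * cinner (A x) x + cnj u * cinner (B x) x)"
      unfolding Tz unfolding z_def cinner_scaleR_left cinner_scaleR_right
      by (simp add: cinner_prod_def cinner_scaleC_left cinner_scaleC_right power2_eq_square)
    also have "\<dots> = of_real (h\<^sup>2) * (u * cinner (A x + \<epsilon> *\<^sub>R B x) x)"
      by (simp add: cnj_u cinner_add_left cinner_scaleR_left algebra_simps)
    finally have "s = h\<^sup>2 * cmod (cinner (A x + \<epsilon> *\<^sub>R B x) x)"
      unfolding s_def by (simp only: norm_mult norm_of_real cu abs_power2 mult_1_left)
    then have s: "cmod (cinner (A x + \<epsilon> *\<^sub>R B x) x) = 2 * s"
      unfolding h2 by linarith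
    have "t = h\<^sup>2 * ((norm (A x))\<^sup>2 + (norm (B x))\<^sup>2)"
      by (simp add: t_def Tz norm_prod_def norm_scaleC cu power_mult_distrib real_sqrt_pow2
          flip: distrib_left)
    then have t: "(norm (A x))\<^sup>2 + (norm (B x))\<^sup>2 = 2 * t"
      by (simp add: h2)
    \<comment> \<open>Moving the adjoints across turns the quadratic form of \<open>?G\<close> at
      \<open>x\<close> into twice the real part of \<open>cinner (B x) (A x)\<close>, the cross term
      of the squared norm.\<close>
    have "2 * (\<epsilon> * Re (cinner (B x) (A x))) = \<epsilon> * Re (cinner x (?G x))"
      using Re_cinner_commute[of "B x" "A x"]
      by (simp add: cinner_add_right cinner_cadjoint[OF A, symmetric] cinner_cadjoint[OF B, symmetric])
    also have "\<dots> \<le> cmod (cinner x (?G x))"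
      using \<epsilon> abs_Re_le_cmod[of "cinner x (?G x)"] by (auto simp: abs_if split: if_splits)
    also have "\<dots> \<le> norm x * norm (?G x)"
      by (rule cmod_cinner_le)
    also have "\<dots> \<le> onorm ?G"
      using onorm[OF G, of x] x by simp
    finally have cross: "2 * (\<epsilon> * Re (cinner (B x) (A x))) \<le> onorm ?G" .
    have "(norm (A x + \<epsilon> *\<^sub>R B x))\<^sup>2 \<le> 2 * t + onorm ?G"
      using cross t by (simp add: norm_add_scaleR_sq \<epsilon>2)
    then have "((norm (A x + \<epsilon> *\<^sub>R B x))\<^sup>2)\<^sup>2 \<le> (2 * t + onorm ?G)\<^sup>2"
      by (intro power_mono) auto
    then have "norm (A x + \<epsilon> *\<^sub>R B x) ^ 4 \<le> (2 * t + onorm ?G)\<^sup>2"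
      by simp
    \<comment> \<open>The summand 0 exhibits the plane vector as (2 s, 2 t) plus (0,
      \<open>onorm ?G\<close>), ready for the Euclidean triangle inequality.\<close>
    then have "sqrt ((cmod (cinner (A x + \<epsilon> *\<^sub>R B x) x))\<^sup>2 + norm (A x + \<epsilon> *\<^sub>R B x) ^ 4)
        \<le> sqrt ((2 * s + 0)\<^sup>2 + (2 * t + onorm ?G)\<^sup>2)"
      by (simp add: s)
    also have "\<dots> \<le> sqrt ((2 * s)\<^sup>2 + (2 * t)\<^sup>2) + sqrt (0\<^sup>2 + (onorm ?G)\<^sup>2)"
      by (rule real_sqrt_sum_squares_triangle_ineq)
    also have "\<dots> = 2 * sqrt (s\<^sup>2 + t\<^sup>2) + onorm ?G"
    proof -
      have "(2 * s)\<^sup>2 + (2 * t)\<^sup>2 = 2\<^sup>2 * (s\<^sup>2 + t\<^sup>2)"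
        by (simp add: power_mult_distrib)
      then have "sqrt ((2 * s)\<^sup>2 + (2 * t)\<^sup>2) = 2 * sqrt (s\<^sup>2 + t\<^sup>2)"
        by (simp only: real_sqrt_mult real_sqrt_abs abs_numeral)
      then show ?thesis
        using G_nonneg by simp
    qed
    also have "sqrt (s\<^sup>2 + t\<^sup>2) \<le> dw ?T"
      using dw_upper[OF T norm_z] by (simp add: s_def t_def)
    finally show "sqrt ((cmod (cinner (A x + \<epsilon> *\<^sub>R B x) x))\<^sup>2 + norm (A x + \<epsilon> *\<^sub>R B x) ^ 4)
        \<le> 2 * dw ?T + onorm ?G" by simp
  next
    show "0 \<le> 2 * dw ?T + onorm ?G"
      using dw_nonneg[OF T] G_nonneg by simp
  qed
qed

theorem theorem3p9:
  fixes A B :: "'a::chilbert_space \<Rightarrow> 'a"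
  assumes "bounded_clinear A" and "bounded_clinear B"
  shows "1 / 2 * (max (dw (\<lambda>x. A x + B x)) (dw (\<lambda>x. A x - B x))
             - onorm (\<lambda>x. cadjoint A (B x) + cadjoint B (A x)))
         \<le> dw (op_matrix (\<lambda>_. 0) A B (\<lambda>_. 0))"
  using dw_add_scaleR_le[OF assms, of 1 1] dw_add_scaleR_le[OF assms, of \<i> "-1"] by simp

end
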